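(* Let $G$ be a closed group with $\operatorname{GL}(\omega,2)\lneqq G\leq\operatorname{Sym}(\mathbb{F}_2^\omega)_0$. Then $G=\operatorname{Sym}(\mathbb{F}_2^\omega)_0$.
   Context: $\mathbb{F}_2^\omega$ denotes the countably infinite dimensional vector space over the two element field, $\operatorname{GL}(\omega,2)$ its automorphism group, $\operatorname{Sym}(\mathbb{F}_2^\omega)$ the group of all permutations of its elements, and $\operatorname{Sym}(\mathbb{F}_2^\omega)_0$ the stabilizer of the zero vector in $\operatorname{Sym}(\mathbb{F}_2^\omega)$. A subgroup $H\le \operatorname{Sym}(\Omega)$ is closed if it is closed in the topology of pointwise convergence: whenever $\pi\in\operatorname{Sym}(\Omega)$ is such that for every finite $S\subset\Omega$ there is $\sigma_S\in H$ with $\sigma_S|_S=\pi|_S$, then $\pi\in H$. *)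

theory Defs
  imports Complex_Main "HOL-Library.Z2" "HOL-Library.Countable_Set"
    "HOL-Algebra.Bij" "HOL-Algebra.Group_Action"
begin

(* The space is characterised up to isomorphism, by a countably infinite basis; the type 'v is
   the set of its vectors. *)
locale F2_omega = vector_space scale
  for scale :: "bit \<Rightarrow> 'v::ab_group_add \<Rightarrow> 'v" +
  assumes countably_infinite_basis:
    "\<exists>B. independent B \<and> span B = UNIV \<and> countable B \<and> infinite B"

(* On UNIV the extensionality condition in BijGroup is void, so the carrier consists of all
   bijections 'a => 'a; the multiplication is composition. *)
abbreviation Sym :: "('a \<Rightarrow> 'a) monoid"
  where "Sym \<equiv> BijGroup UNIV"

abbreviation Sym_stab :: "'a \<Rightarrow> ('a \<Rightarrow> 'a) set"
  where "Sym_stab x \<equiv> stabilizer Sym (\<lambda>g. g) x"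

definition GL :: "('k::field \<Rightarrow> 'v::ab_group_add \<Rightarrow> 'v) \<Rightarrow> ('v \<Rightarrow> 'v) set"
  where "GL scale = {g \<in> carrier Sym. Vector_Spaces.linear scale scale g}"

(* Closed in Sym (not in the space of all functions) for pointwise convergence. *)
definition closed_in_Sym :: "('a \<Rightarrow> 'a) set \<Rightarrow> bool"
  where "closed_in_Sym H \<longleftrightarrow>
    (\<forall>\<pi> \<in> carrier Sym.
      (\<forall>S. finite S \<longrightarrow> (\<exists>\<sigma> \<in> H. restrict \<sigma> S = restrict \<pi> S)) \<longrightarrow> \<pi> \<in> H)"

end

theory Submission
  imports Defs
begin

text \<open>
  By homogeneity of the vector space and closedness of \<open>G\<close>, it suffices that every finite set of
  nonzero vectors is mapped by some element of \<open>G\<close> to an independent set; this goes by induction on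
  its size. A nonlinear element breaks up a line \<open>{a, b, a + b}\<close>, which settles size 3.
  Suppose size \<open>n \<ge> 3\<close> is settled and size \<open>n + 1\<close> is not. For an independent \<open>I\<close> of size \<open>n\<close>, the
  set \<open>I \<union> {x}\<close> can be bad only for \<open>x = \<Sum>I\<close>: if \<open>x\<close> were in the span of a proper subset \<open>I - {j}\<close>, then
  moving \<open>j\<close> by linear maps would force infinitely many vectors into a finite span. Transporting
  by \<open>G\<close>, every set \<open>U\<close> of \<open>n\<close> nonzero vectors has exactly one bad extension \<open>y\<close>, which is then fixed
  by the setwise stabilizer of \<open>U\<close> in \<open>GL\<close>. But if \<open>U\<close> consists of \<open>n - 1\<close> independent vectors and
  their sum, this stabilizer fixes no nonzero vector outside \<open>U\<close>.
\<close>

section \<open>Permutations as ordinary bijections\<close>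

lemma carrier_Sym: "carrier Sym = {f. bij f}"
  by (simp add: BijGroup_def Bij_def)

lemma mult_Sym:
  assumes "bij f" "bij g"
  shows "f \<otimes>\<^bsub>Sym\<^esub> g = f \<circ> g"
  using assms by (simp add: BijGroup_def Bij_def compose_def fun_eq_iff)

lemma inv_Sym:
  assumes "bij f"
  shows "inv\<^bsub>Sym\<^esub> f = Hilbert_Choice.inv f"
proof -
  have "bij (Hilbert_Choice.inv f)"
    using assms by (rule bij_imp_bij_inv)
  moreover have "Hilbert_Choice.inv f \<circ> f = \<one>\<^bsub>Sym\<^esub>"
    using assms by (simp add: BijGroup_def fun_eq_iff bij_is_inj)
  ultimately show ?thesis
    using assms group.inv_equality[OF group_BijGroup[of UNIV], of "Hilbert_Choice.inv f" f]
    by (simp add: mult_Sym carrier_Sym)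
qed

lemma GL_iff: "h \<in> GL scale \<longleftrightarrow> bij h \<and> Vector_Spaces.linear scale scale h"
  by (simp add: GL_def carrier_Sym)

section \<open>Linear algebra over the two-element field\<close>

context F2_omega
begin

interpretation vector_space_pair scale scale
  by unfold_locales

lemma add_self [simp]: "x + x = (0 :: 'v)"
proof -
  have "x + x = scale (1 + 1) x"
    by (simp only: scale_left_distrib scale_one)
  then show ?thesis by simp
qed

text \<open>Every scalar is 0 or 1, so a linear combination is the sum of the vectors with
  coefficient 1.\<close>

lemma span_eq_subset_sums: "span S = {(\<Sum>J) | J. finite J \<and> J \<subseteq> S}"
proof (intro equalityI subsetI)
  fix x assume "x \<in> span S"
  then obtain t r where t: "finite t" "t \<subseteq> S" "x = (\<Sum>a\<in>t. scale (r a) a)"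
    by (auto simp: span_explicit)
  have "x = (\<Sum>a\<in>t. if r a = 1 then a else 0)"
    unfolding t(3) by (rule sum.cong) auto
  also have "\<dots> = \<Sum>{a \<in> t. r a = 1}"
    using t(1) by (simp add: sum.If_cases Int_def)
  finally show "x \<in> {(\<Sum>J) | J. finite J \<and> J \<subseteq> S}"
    using t by (auto intro!: exI[of _ "{a \<in> t. r a = 1}"])
next
  fix x assume "x \<in> {(\<Sum>J) | J. finite J \<and> J \<subseteq> S}"
  then show "x \<in> span S"
    by (auto intro: span_sum span_base)
qed

lemma finite_span: "finite S \<Longrightarrow> finite (span S)"
  unfolding span_eq_subset_sums
  by (rule finite_surj[of "Pow S" _ "\<lambda>J. \<Sum>J"]) auto

lemma countable_UNIV: "countable (UNIV :: 'v set)"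
proof -
  obtain B where B: "span B = UNIV" "countable B"
    using countably_infinite_basis by blast
  have "UNIV = (\<lambda>J. \<Sum>J) ` {J. finite J \<and> J \<subseteq> B}"
    using B(1) by (auto simp: span_eq_subset_sums)
  then show ?thesis
    using countable_Collect_finite_subset[OF B(2)] by (metis countable_image)
qed

lemma infinite_UNIV: "infinite (UNIV :: 'v set)"
  using countably_infinite_basis infinite_super[OF subset_UNIV] by blast

lemma infinite_Compl_span: "finite S \<Longrightarrow> infinite (- span S)"
  unfolding Compl_eq_Diff_UNIV by (rule Diff_infinite_finite[OF finite_span infinite_UNIV])

text \<open>Homogeneity of the space: \<open>A\<close> and its image are completed to bases by
  countably infinite sets, and matching these gives a linear map with a linear inverse.\<close>

lemma ex_GL_extend:
  assumes "finite A" "independent A" "independent (f ` A)" "inj_on f A"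
  shows "\<exists>h\<in>GL scale. \<forall>x\<in>A. h x = f x"
proof -
  \<comment> \<open>Finite sets have finite span, so a basis containing \<open>A'\<close> is
    infinite, and it remains so without \<open>A'\<close>.\<close>
  have ext: "\<exists>B'. independent (A' \<union> B') \<and> A' \<inter> B' = {} \<and> span (A' \<union> B') = UNIV
      \<and> countable B' \<and> infinite B'"
    if A': "finite A'" "independent A'" for A'
  proof -
    obtain B where B: "A' \<subseteq> B" "independent B" "UNIV \<subseteq> span B"
      by (rule maximal_independent_subset_extend[OF subset_UNIV A'(2)])
    have "infinite B"
      using B(3) finite_span infinite_UNIV by (metis finite_subset)
    then have "infinite (B - A')" using A'(1) by simp
    moreover have "countable (B - A')"
      by (rule countable_subset[OF subset_UNIV countable_UNIV])
    moreover have "A' \<union> (B - A') = B" using B(1) by blast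
    ultimately show ?thesis
      using B(2,3) by (intro exI[of _ "B - A'"]) auto
  qed
  obtain B where B: "independent (A \<union> B)" "A \<inter> B = {}" "span (A \<union> B) = UNIV"
      "countable B" "infinite B"
    using ext[OF assms(1,2)] by blast
  obtain C where C: "independent (f ` A \<union> C)" "f ` A \<inter> C = {}" "span (f ` A \<union> C) = UNIV"
      "countable C" "infinite C"
    using ext[of "f ` A"] assms(1,3) by blast
  obtain k where k: "bij_betw k B C"
    using B(4,5) C(4,5) by (metis bij_betw_from_nat_into bij_betw_trans to_nat_on_infinite)
  define F where "F x = (if x \<in> A then f x else k x)" for x
  have "bij_betw F A (f ` A)"
    using assms(4) by (auto simp: F_def bij_betw_def inj_on_def)
  moreover have "bij_betw F B C"
  proof -
    have "F x = k x" if "x \<in> B" for x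
      using that B(2) by (auto simp: F_def)
    then show ?thesis
      using k bij_betw_cong by blast
  qed
  ultimately have F: "bij_betw F (A \<union> B) (f ` A \<union> C)"
    using C(2) by (rule bij_betw_combine)
  obtain h where h: "Vector_Spaces.linear scale scale h" "\<forall>x\<in>A \<union> B. h x = F x"
    using linear_independent_extend[OF B(1)] by blast
  obtain h' where h': "Vector_Spaces.linear scale scale h'"
      "\<forall>x\<in>f ` A \<union> C. h' x = inv_into (A \<union> B) F x"
    using linear_independent_extend[OF C(1)] by blast
  \<comment> \<open>\<open>h\<close> and \<open>h'\<close> exchange the two bases by mutually
    inverse maps, so both composites are the identity on a basis.\<close>
  have "(h' \<circ> h) x = id x" for x
  proof (rule linear_eq_on[of "h' \<circ> h" id _ "A \<union> B"])
    show "Vector_Spaces.linear scale scale (h' \<circ> h)"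
      using h(1) h'(1) by (rule Vector_Spaces.linear_compose)
    show "Vector_Spaces.linear scale scale id"
      by (rule linear_id)
    show "x \<in> span (A \<union> B)" using B(3) by simp
    show "(h' \<circ> h) b = id b" if "b \<in> A \<union> B" for b
      using that h(2) h'(2) F bij_betwE bij_betw_inv_into_left by fastforce
  qed
  moreover have "(h \<circ> h') x = id x" for x
  proof (rule linear_eq_on[of "h \<circ> h'" id _ "f ` A \<union> C"])
    show "Vector_Spaces.linear scale scale (h \<circ> h')"
      using h'(1) h(1) by (rule Vector_Spaces.linear_compose)
    show "Vector_Spaces.linear scale scale id"
      by (rule linear_id)
    show "x \<in> span (f ` A \<union> C)" using C(3) by simp
    fix b assume b: "b \<in> f ` A \<union> C"
    then have "inv_into (A \<union> B) F b \<in> A \<union> B"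
      using F by (metis bij_betw_def inv_into_into)
    then show "(h \<circ> h') b = id b"
      using b h(2) h'(2) F bij_betw_inv_into_right by fastforce
  qed
  ultimately have "bij h"
    by (metis comp_apply id_apply bijI')
  moreover have "\<forall>x\<in>A. h x = f x"
    using h(2) by (auto simp: F_def)
  ultimately show ?thesis
    using h(1) by (auto simp: GL_iff)
qed

text \<open>The pointwise stabilizer of \<open>A\<close> in \<open>GL\<close> is transitive off the
  span: adjoining \<open>x\<close> or \<open>y\<close> keeps \<open>A\<close> independent.\<close>

lemma ex_GL_insert:
  assumes "finite A" "independent A" "x \<notin> span A" "y \<notin> span A"
  shows "\<exists>h\<in>GL scale. (\<forall>a\<in>A. h a = a) \<and> h x = y"
proof -
  define f where "f = id(x := y)"
  have nx: "x \<notin> A" and ny: "y \<notin> A"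
    using assms(3,4) span_base by auto
  have "f ` insert x A = insert y A"
    using nx by (auto simp: f_def image_iff)
  moreover have "inj_on f (insert x A)"
    using nx ny by (auto simp: f_def inj_on_def)
  ultimately obtain h where h: "h \<in> GL scale" "\<forall>a\<in>insert x A. h a = f a"
    using ex_GL_extend[of "insert x A" f] assms by (auto simp: independent_insertI)
  have "h x = y" "\<forall>a\<in>A. h a = a"
    using h(2) nx by (auto simp: f_def)
  then show ?thesis
    using h(1) by blast
qed

lemma sum_not_in_independent:
  assumes "finite F" "independent F" "card F \<ge> 2"
  shows "\<Sum>F \<notin> F" "\<Sum>F \<noteq> 0"
proof -
  \<comment> \<open>The value \<open>c\<close> treats a zero sum and a sum lying in \<open>F\<close>
    at once: any \<open>b\<close> in \<open>F\<close> other than \<open>a\<close> would lie in the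
    span of the rest.\<close>
  have False if "a \<in> F" "\<Sum>F = c" "c \<in> {0, a}" for a c
  proof -
    have "card (F - {a}) \<ge> 1" using that assms by simp
    then obtain b where b: "b \<in> F" "b \<noteq> a"
      by (metis Diff_iff card.empty equals0I not_one_le_zero singletonI)
    have "\<Sum>F = b + \<Sum>(F - {b})"
      using assms(1) b(1) by (rule sum.remove)
    then have "b = c - \<Sum>(F - {b})" using that by simp
    moreover have "\<Sum>(F - {b}) \<in> span (F - {b})"
      by (intro span_sum span_base)
    moreover have "c \<in> span (F - {b})"
      using that b by (auto intro: span_base span_zero)
    ultimately have "b \<in> span (F - {b})"
      using span_diff by metis
    then show False using assms(2) b(1) dependent_def by blast
  qed
  moreover obtain a where "a \<in> F"
    using assms(3) by fastforce
  ultimately show "\<Sum>F \<notin> F" "\<Sum>F \<noteq> 0"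
    by blast+
qed

lemma independent_card_le_2:
  assumes "finite T" "0 \<notin> T" "card T \<le> 2"
  shows "independent T"
proof -
  consider "card T = 0" | "card T = 1" | "card T = 2"
    using assms(3) by linarith
  then show ?thesis
  proof cases
    case 1
    then show ?thesis using assms(1) by (simp add: independent_empty)
  next
    case 2
    then show ?thesis using assms(2) by (auto simp: card_1_singleton_iff)
  next
    case 3
    then obtain a b where T: "T = {a, b}" "a \<noteq> b"
      by (auto simp: card_2_iff)
    have "a \<notin> span {b}"
      using T assms(2) by (auto simp: span_eq_subset_sums subset_singleton_iff)
    then show ?thesis
      using T assms(2) independent_insertI[of a "{b}"] by auto
  qed
qed

text \<open>The span of \<open>{a, b}\<close> consists of \<open>0\<close>, \<open>a\<close>,
  \<open>b\<close> and \<open>a + b\<close>, all excluded for \<open>c\<close>.\<close>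

lemma independent_triple:
  assumes "a \<noteq> 0" "b \<noteq> 0" "c \<noteq> 0" "a \<noteq> b" "a \<noteq> c" "b \<noteq> c" "c \<noteq> a + b"
  shows "independent {c, a, b}"
proof -
  have "c \<notin> span {a, b}"
  proof
    assume "c \<in> span {a, b}"
    then obtain J where "c = \<Sum>J" "J \<subseteq> {a, b}"
      by (auto simp: span_eq_subset_sums)
    then have "J = {} \<or> J = {a} \<or> J = {b} \<or> J = {a, b}"
      by blast
    then show False
      using \<open>c = \<Sum>J\<close> assms by auto
  qed
  moreover have "independent {a, b}"
    using assms by (intro independent_card_le_2) auto
  ultimately show ?thesis
    by (rule independent_insertI)
qed

end

section \<open>Groups containing the general linear group and fixing zero\<close>

locale GL_supergroup = F2_omega scale
  for scale :: "bit \<Rightarrow> 'v::ab_group_add \<Rightarrow> 'v" +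
  fixes G :: "('v \<Rightarrow> 'v) set"
  assumes bij: "g \<in> G \<Longrightarrow> bij g"
    and comp: "g \<in> G \<Longrightarrow> h \<in> G \<Longrightarrow> g \<circ> h \<in> G"
    and inv: "g \<in> G \<Longrightarrow> Hilbert_Choice.inv g \<in> G"
    and fixes_zero: "g \<in> G \<Longrightarrow> g 0 = 0"
    and GL_subset: "GL scale \<subseteq> G"
begin

text \<open>The bad sets are those without this property, which is constant on
  \<open>G\<close>-orbits of sets.\<close>

definition straightenable :: "'v set \<Rightarrow> bool"
  where "straightenable T \<longleftrightarrow> (\<exists>g\<in>G. independent (g ` T))"

lemma id_in: "id \<in> G"
  using GL_subset linear_id by (auto simp: GL_iff)

lemma independent_imp_straightenable: "independent T \<Longrightarrow> straightenable T"
  unfolding straightenable_def using id_in by force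

lemma straightenable_image:
  assumes "g \<in> G" "straightenable (g ` T)"
  shows "straightenable T"
  using assms comp unfolding straightenable_def by (metis image_comp)

lemma straightenable_image_iff:
  assumes "g \<in> G"
  shows "straightenable (g ` T) \<longleftrightarrow> straightenable T"
proof
  assume "straightenable T"
  moreover have "Hilbert_Choice.inv g ` g ` T = T"
    using bij[OF assms] by (simp add: bij_is_inj image_inv_f_f)
  ultimately show "straightenable (g ` T)"
    using straightenable_image[OF inv[OF assms]] by metis
qed (use assms straightenable_image in blast)

lemma G_eq_iff: "g \<in> G \<Longrightarrow> g x = g y \<longleftrightarrow> x = y"
  using bij by (simp add: bij_is_inj inj_eq)

lemma G_eq_0_iff: "g \<in> G \<Longrightarrow> g x = 0 \<longleftrightarrow> x = 0"
  using G_eq_iff fixes_zero by metis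

lemma card_image_G: "g \<in> G \<Longrightarrow> card (g ` T) = card T"
  using bij by (meson bij_is_inj card_image inj_on_subset subset_UNIV)

section \<open>Induction on the size of the set\<close>

text \<open>Leaves a single candidate for a bad extension of \<open>I\<close>, without claiming that
  this candidate is bad.\<close>

lemma eq_sum_if_not_straightenable:
  assumes step: "\<And>T. finite T \<Longrightarrow> 0 \<notin> T \<Longrightarrow> card T = card I \<Longrightarrow> straightenable T"
    and I: "finite I" "independent I"
    and x: "x \<noteq> 0" "x \<notin> I" "\<not> straightenable (insert x I)"
  shows "x = \<Sum>I"
proof (rule ccontr)
  assume ne: "x \<noteq> \<Sum>I"
  have "x \<in> span I"
    using x(3) I(2) independent_imp_straightenable independent_insertI by blast
  then obtain J where J: "x = \<Sum>J" "J \<subseteq> I"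
    by (auto simp: span_eq_subset_sums)
  then have "J \<noteq> I"
    using ne by blast
  then obtain j where j: "j \<in> I" "j \<notin> J"
    using J(2) by blast
  define K where "K = I - {j}"
  have K: "finite K" "I = insert j K" "j \<notin> K"
    using I(1) j by (auto simp: K_def)
  have indK: "independent K" "j \<notin> span K"
    using I(2) K(2,3) by (simp_all add: independent_insert)
  have JK: "J \<subseteq> K"
    using J(2) j(2) by (auto simp: K_def)
  then have xK: "x \<in> span K"
    unfolding J(1) by (intro span_sum) (use span_base in blast)
  \<comment> \<open>Trading \<open>j\<close> for \<open>x\<close> keeps the size, so
    \<open>step\<close> straightens the resulting set although it is dependent.\<close>
  have "0 \<notin> insert x K"
    using x(1) indK(1) dependent_zero by blast
  moreover have "card (insert x K) = card I"
    using K x(2) by simp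
  ultimately have "straightenable (insert x K)"
    using K(1) by (intro step) auto
  then obtain g where g: "g \<in> G" "independent (g ` insert x K)"
    by (auto simp: straightenable_def)
  \<comment> \<open>Otherwise \<open>g\<close> also straightens the set with \<open>z\<close> added.
    A linear map fixing \<open>K\<close>, hence \<open>x\<close>, and taking \<open>j\<close> to
    \<open>z\<close> carries \<open>insert x I\<close> onto that set.\<close>
  have "g z \<in> span (g ` insert x K)" if z: "z \<notin> span K" for z
  proof (rule ccontr)
    assume "g z \<notin> span (g ` insert x K)"
    then have "independent (g ` insert z (insert x K))"
      unfolding image_insert[of g z] using g(2) by (rule independent_insertI)
    then have "straightenable (insert z (insert x K))"
      using g(1) unfolding straightenable_def by blast
    moreover obtain h where h: "h \<in> GL scale" "\<forall>a\<in>K. h a = a" "h j = z"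
      using ex_GL_insert[OF K(1) indK z] by blast
    have "h x = x"
    proof -
      interpret h: Vector_Spaces.linear scale scale h
        using h(1) by (simp add: GL_iff)
      show ?thesis
        unfolding J(1) h.sum using JK h(2) by (intro sum.cong) auto
    qed
    then have "h ` insert x I = insert z (insert x K)"
      using K(2) h by auto
    ultimately show False
      using x(3) h(1) GL_subset straightenable_image by (metis subsetD)
  qed
  \<comment> \<open>An injective map cannot send an infinite complement into a finite span.\<close>
  then have "g ` (- span K) \<subseteq> span (g ` insert x K)"
    by blast
  moreover have "inj_on g (- span K)"
    using bij[OF g(1)] by (meson bij_is_inj inj_on_subset subset_UNIV)
  ultimately have "finite (- span K)"
    using K(1) finite_span by (meson finite.insertI finite_imageD finite_imageI finite_subset)
  then show False
    using infinite_Compl_span K(1) by blast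
qed

text \<open>A vector outside the span of \<open>F\<close> moves while \<open>F\<close> is fixed
  pointwise; one inside moves under a transposition of two elements of \<open>F\<close>.\<close>

lemma ex_GL_moving:
  assumes F: "finite F" "independent F" "card F \<ge> 2"
    and y: "y \<noteq> 0" "y \<noteq> \<Sum>F"
  shows "\<exists>h\<in>GL scale. h ` F = F \<and> h (\<Sum>F) = \<Sum>F \<and> h y \<noteq> y"
proof (cases "y \<in> span F")
  case False
  have "infinite (- span F - {y})"
    using infinite_Compl_span[OF F(1)] by simp
  then obtain z where z: "z \<notin> span F" "z \<noteq> y"
    by (metis ComplD DiffE infinite_imp_nonempty equals0I singletonI)
  obtain h where h: "h \<in> GL scale" "\<forall>a\<in>F. h a = a" "h y = z"
    using ex_GL_insert[OF F(1,2) False z(1)] by blast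
  interpret h: Vector_Spaces.linear scale scale h
    using h(1) by (simp add: GL_iff)
  have "h (\<Sum>F) = \<Sum>F"
    using h(2) by (auto simp: h.sum intro!: sum.cong)
  moreover have "h ` F = F" using h(2) by force
  ultimately show ?thesis using h z by blast
next
  case True
  then obtain J where J: "y = \<Sum>J" "J \<subseteq> F"
    by (auto simp: span_eq_subset_sums)
  \<comment> \<open>\<open>J\<close> is nonempty because \<open>y\<close> is nonzero, and proper
    because \<open>y\<close> is not the full sum.\<close>
  then obtain p q where pq: "p \<in> J" "q \<in> F" "q \<notin> J"
    using y by (metis all_not_in_conv subsetI subset_antisym sum.empty)
  define f where "f = id(p := q, q := p)"
  have im: "f ` F = F"
    using pq J by (auto simp: f_def image_iff)
  have "inj_on f F"
    by (auto simp: f_def inj_on_def)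
  then obtain h where h: "h \<in> GL scale" "\<forall>a\<in>F. h a = f a"
    using ex_GL_extend[OF F(1,2), of f] F(2) unfolding im by blast
  interpret h: Vector_Spaces.linear scale scale h
    using h(1) by (simp add: GL_iff)
  have hF: "h ` F = F" using h(2) im by simp
  have "inj_on h F"
    using h(1) by (meson GL_iff bij_is_inj inj_on_subset subset_UNIV)
  then have "h (\<Sum>F) = \<Sum>F"
    using sum.reindex[of h F "\<lambda>x. x"] unfolding h.sum hF by simp
  moreover have "h y \<noteq> y"
  proof
    assume eq: "h y = y"
    have fJ: "finite J" using J F finite_subset by blast
    have "y = p + \<Sum>(J - {p})"
      unfolding J(1) using fJ pq(1) by (rule sum.remove)
    moreover have "h p = q"
      using h(2) pq J by (auto simp: f_def)
    moreover have "h (\<Sum>(J - {p})) = \<Sum>(J - {p})"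
      unfolding h.sum
    proof (intro sum.cong refl)
      fix a assume "a \<in> J - {p}"
      then have "a \<in> F" "a \<noteq> p" "a \<noteq> q"
        using J(2) pq(3) by auto
      then show "h a = a"
        using h(2) by (simp add: f_def)
    qed
    \<comment> \<open>\<open>h\<close> replaces the summand \<open>p\<close> by \<open>q\<close> and
      fixes all others, so these cancel.\<close>
    ultimately have "p = q"
      using eq h.add by (metis add_right_cancel)
    then show False using pq by simp
  qed
  ultimately show ?thesis using h hF by blast
qed

lemma straightenable_Suc:
  assumes step: "\<And>T. finite T \<Longrightarrow> 0 \<notin> T \<Longrightarrow> card T = n \<Longrightarrow> straightenable T"
    and n: "n \<ge> 3"
    and T: "finite T" "0 \<notin> T" "card T = Suc n"
  shows "straightenable T"
proof (rule ccontr)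
  assume bad: "\<not> straightenable T"
  obtain x T0 where x: "T = insert x T0" "x \<notin> T0" "card T0 = n"
    using T(3) by (auto simp: card_Suc_eq)
  then obtain g where g: "g \<in> G" "independent (g ` T0)"
    using step[of T0] T by (auto simp: straightenable_def)
  define I where "I = g ` T0"
  have I: "finite I" "independent I" "card I = n"
    using g T x card_image_G by (auto simp: I_def)
  have "\<not> straightenable (insert (g x) I)"
    using bad g(1) x(1) straightenable_image by (metis I_def image_insert)
  moreover have "g x \<noteq> 0" "g x \<notin> I"
    using g(1) x T G_eq_0_iff G_eq_iff by (auto simp: I_def)
  \<comment> \<open>The only candidate is the sum, so \<open>g x = \<Sum>I\<close>.\<close>
  ultimately have bad_I: "\<not> straightenable (insert (\<Sum>I) I)"
    using eq_sum_if_not_straightenable[of I "g x"] I step by metis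
  obtain i where i: "i \<in> I"
    using I(3) n by fastforce
  \<comment> \<open>Since \<open>n \<ge> 3\<close>, at least two vectors remain, so their sum
    \<open>s\<close> is a new nonzero vector and \<open>U\<close> again has size
    \<open>n\<close>.\<close>
  define F where "F = I - {i}"
  define s where "s = \<Sum>F"
  define U where "U = insert s F"
  have F: "finite F" "independent F" "card F \<ge> 2"
    using I i n independent_mono[OF I(2), of F] by (auto simp: F_def)
  note s = sum_not_in_independent[OF F, folded s_def]
  have U: "finite U" "0 \<notin> U" "card U = n"
    using F s I i n dependent_zero by (auto simp: U_def F_def)
  obtain k where k: "k \<in> G" "independent (k ` U)"
    using step[OF U] by (auto simp: straightenable_def)
  define E where "E = k ` U"
  have E: "finite E" "independent E" "card E = n"
    using k U card_image_G by (auto simp: E_def)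
  \<comment> \<open>Independent sets of size \<open>n\<close> are conjugate under \<open>GL\<close>,
    so badness of the sum passes from \<open>I\<close> to \<open>E\<close>.\<close>
  obtain f where f: "bij_betw f I E"
    using I E finite_same_card_bij by metis
  obtain h where h: "h \<in> GL scale" "\<forall>a\<in>I. h a = f a"
    using ex_GL_extend[of I f] I E f by (metis bij_betw_def)
  have bij_hI: "bij_betw h I E"
    using f h(2) bij_betw_cong by metis
  have "h (\<Sum>I) = \<Sum>E"
  proof -
    interpret h: Vector_Spaces.linear scale scale h
      using h(1) by (simp add: GL_iff)
    show ?thesis
      using sum.reindex_bij_betw[OF bij_hI, of "\<lambda>x. x"] by (simp add: h.sum)
  qed
  then have bad_E: "\<not> straightenable (insert (\<Sum>E) E)"
    using bad_I h(1) GL_subset straightenable_image_iff bij_hI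
    by (metis bij_betw_imp_surj_on image_insert subsetD)
  obtain y where y: "k y = \<Sum>E"
    using bij[OF k(1)] by (metis bij_is_surj surjD)
  have "\<Sum>E \<notin> E" "\<Sum>E \<noteq> 0"
    using sum_not_in_independent[of E] E n by auto
  then have yU: "y \<noteq> 0" "y \<notin> U"
    using y fixes_zero[OF k(1)] unfolding E_def by (metis, metis imageI)
  have bad_y: "\<not> straightenable (insert y U)"
    using bad_E k(1) y straightenable_image_iff by (metis E_def image_insert)
  \<comment> \<open>\<open>y\<close> is the only vector that spoils \<open>U\<close>, so it is fixed by every symmetry of \<open>U\<close>.\<close>
  obtain l where l: "l \<in> GL scale" "l ` F = F" "l s = s" "l y \<noteq> y"
    using ex_GL_moving[OF F, of y] yU by (auto simp: U_def s_def)
  then have lG: "l \<in> G" and lU: "l ` U = U"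
    using GL_subset by (auto simp: U_def)
  have "\<not> straightenable (insert (l y) U)"
    using bad_y lG lU straightenable_image_iff by (metis image_insert)
  then have "\<not> straightenable (insert (k (l y)) E)"
    using k(1) straightenable_image_iff by (metis E_def image_insert)
  moreover have "l y \<noteq> 0" "l y \<notin> U"
    using yU lU G_eq_0_iff[OF lG] G_eq_iff[OF lG] by (metis, metis imageE)
  then have "k (l y) \<noteq> 0" "k (l y) \<notin> E"
    using G_eq_0_iff[OF k(1)] G_eq_iff[OF k(1)] unfolding E_def by (metis, metis imageE)
  \<comment> \<open>\<open>l y\<close> spoils \<open>U\<close> too, so its image under
    \<open>k\<close> is the one candidate for \<open>E\<close>, which is already
    \<open>k y\<close>.\<close>
  ultimately have "k (l y) = \<Sum>E"
    using eq_sum_if_not_straightenable[of E "k (l y)"] E step by metis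
  then show False
    using y l(4) k(1) G_eq_iff by metis
qed

text \<open>A dependent triple is a line \<open>{u, v, u + v}\<close>. All lines are conjugate under
  \<open>GL\<close>, so it suffices that a nonlinear element breaks one of them.\<close>

lemma straightenable_card_3:
  assumes ne: "G \<noteq> GL scale" and T: "0 \<notin> T" "card T = 3"
  shows "straightenable T"
proof -
  obtain g where g: "g \<in> G" "g \<notin> GL scale"
    using ne GL_subset by blast
  have "\<exists>a b. g (a + b) \<noteq> g a + g b"
  proof (rule ccontr)
    assume "\<nexists>a b. g (a + b) \<noteq> g a + g b"
    \<comment> \<open>With scalars 0 and 1 only, homogeneity is just \<open>g 0 = 0\<close>, so
      failure of linearity is failure of additivity.\<close>
    moreover have "g (scale c x) = scale c (g x)" for c x
      using fixes_zero[OF g(1)] by (cases c) auto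
    ultimately have "Vector_Spaces.linear scale scale g"
      by (simp add: Vector_Spaces.linear_iff vector_space_axioms)
    then show False
      using g bij by (simp add: GL_iff)
  qed
  then obtain a b where ab: "g (a + b) \<noteq> g a + g b"
    by blast
  \<comment> \<open>In each excluded case additivity would hold, by \<open>g 0 = 0\<close> and
    characteristic 2.\<close>
  have nz: "a \<noteq> 0" "b \<noteq> 0" "a \<noteq> b"
    using ab fixes_zero[OF g(1)] by auto
  have sum_nz: "u + v \<noteq> 0" "u \<noteq> u + v" "v \<noteq> u + v" if "u \<noteq> 0" "v \<noteq> 0" "u \<noteq> v" for u v :: 'v
    using that add_self[of v] add_right_cancel[of u v v] by auto
  have "independent {g (a + b), g a, g b}"
    using nz sum_nz[OF nz] ab g(1) by (intro independent_triple) (simp_all add: G_eq_0_iff G_eq_iff)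
  then have line: "straightenable {a + b, a, b}"
    using g(1) unfolding straightenable_def by (intro bexI[of _ g]) simp_all
  obtain u v w where uvw: "T = {u, v, w}" "u \<noteq> v" "u \<noteq> w" "v \<noteq> w"
    using T(2) by (auto simp: card_3_iff)
  have nzT: "u \<noteq> 0" "v \<noteq> 0" "w \<noteq> 0"
    using T(1) uvw by auto
  show ?thesis
  proof (cases "w = u + v")
    case False
    then have "independent {w, u, v}"
      using uvw(2-4) nzT by (intro independent_triple) auto
    then show ?thesis
      using independent_imp_straightenable by (simp add: uvw(1) insert_commute)
  next
    case True
    define f where "f = (\<lambda>x. if x = u then a else b)"
    have im: "f ` {u, v} = {a, b}"
      using uvw by (auto simp: f_def)
    have "independent {u, v}" "independent {a, b}"
      using nzT nz uvw(2) by (intro independent_card_le_2; simp)+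
    moreover have "inj_on f {u, v}"
      using nz(3) uvw(2) by (auto simp: f_def)
    ultimately obtain h where h: "h \<in> GL scale" "\<forall>x\<in>{u, v}. h x = f x"
      using ex_GL_extend[of "{u, v}" f] unfolding im by blast
    interpret h: Vector_Spaces.linear scale scale h
      using h(1) by (simp add: GL_iff)
    have "h ` T = {a + b, a, b}"
      using h(2) uvw True by (auto simp: h.add f_def)
    then show ?thesis
      using line h(1) GL_subset straightenable_image by (metis subsetD)
  qed
qed

lemma straightenable_finite:
  assumes ne: "G \<noteq> GL scale" and "finite T" "0 \<notin> T"
  shows "straightenable T"
proof -
  have "\<forall>T. finite T \<longrightarrow> 0 \<notin> T \<longrightarrow> card T = n \<longrightarrow> straightenable T" for n
  proof (induction n)
    case 0
    then show ?case
      by (intro allI impI independent_imp_straightenable independent_card_le_2) auto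
  next
    case (Suc n)
    consider "Suc n \<le> 2" | "Suc n = 3" | "n \<ge> 3" by linarith
    then show ?case
    proof cases
      case 1
      then show ?thesis
        by (intro allI impI independent_imp_straightenable independent_card_le_2) auto
    next
      case 2
      then show ?thesis using straightenable_card_3[OF ne] by metis
    next
      case 3
      then show ?thesis using straightenable_Suc[of n] Suc.IH by blast
    qed
  qed
  then show ?thesis using assms by blast
qed

text \<open>Straightening both the set and its image under \<open>\<pi>\<close> reduces the claim to
  homogeneity of the space.\<close>

lemma ex_G_agreeing:
  assumes ne: "G \<noteq> GL scale" and \<pi>: "bij \<pi>" "\<pi> 0 = 0" and S: "finite S"
  shows "\<exists>\<sigma>\<in>G. \<forall>x\<in>S. \<sigma> x = \<pi> x"
proof -
  \<comment> \<open>An independent set omits zero; agreement at zero comes from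
    \<open>fixes_zero\<close>.\<close>
  define T where "T = S - {0}"
  have inj: "inj \<pi>" using \<pi> by (simp add: bij_is_inj)
  have "0 \<notin> \<pi> ` T"
    using inj \<pi>(2) by (auto simp: T_def) (metis injD)
  then obtain g g' where g: "g \<in> G" "independent (g ` T)"
      and g': "g' \<in> G" "independent (g' ` \<pi> ` T)"
    using straightenable_finite[OF ne] S unfolding straightenable_def T_def
    by (metis Diff_iff finite_Diff finite_imageI singletonI)
  \<comment> \<open>\<open>f\<close> is \<open>\<pi>\<close> read between the two independent
    images; its restriction there extends to a linear \<open>h\<close>.\<close>
  define f where "f = g' \<circ> \<pi> \<circ> Hilbert_Choice.inv g"
  have invg: "Hilbert_Choice.inv g (g x) = x" for x
    using bij[OF g(1)] by (simp add: bij_is_inj)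
  have "f ` g ` T = g' ` \<pi> ` T"
    by (simp add: f_def image_image invg)
  moreover have "bij f"
    unfolding f_def using bij g(1) g'(1) inv \<pi>(1) by (intro bij_comp) auto
  then have "inj_on f (g ` T)"
    by (meson bij_is_inj inj_on_subset subset_UNIV)
  ultimately obtain h where h: "h \<in> GL scale" "\<forall>x\<in>g ` T. h x = f x"
    using ex_GL_extend[of "g ` T" f] g g' S by (auto simp: T_def)
  define \<sigma> where "\<sigma> = Hilbert_Choice.inv g' \<circ> (h \<circ> g)"
  have "\<sigma> \<in> G"
    unfolding \<sigma>_def using g g' h GL_subset by (blast intro: comp inv)
  moreover have "\<sigma> x = \<pi> x" if "x \<in> S" for x
  proof (cases "x = 0")
    case True
    then show ?thesis using fixes_zero[OF \<open>\<sigma> \<in> G\<close>] \<pi>(2) by simp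
  next
    case False
    then have "h (g x) = g' (\<pi> x)"
      using that h(2) by (simp add: T_def f_def invg)
    then show ?thesis
      using bij[OF g'(1)] by (simp add: \<sigma>_def bij_is_inj)
  qed
  ultimately show ?thesis by blast
qed

end

theorem theorem2p3:
  fixes scale :: "bit \<Rightarrow> 'v::ab_group_add \<Rightarrow> 'v"
    and G :: "('v \<Rightarrow> 'v) set"
  assumes "F2_omega scale"
    and "subgroup G Sym"
    and "closed_in_Sym G"
    and "GL scale \<subset> G"
    and "G \<subseteq> Sym_stab 0"
  shows "G = Sym_stab 0"
proof
  have stab: "Sym_stab 0 = {g :: 'v \<Rightarrow> 'v. bij g \<and> g 0 = 0}"
    by (simp add: stabilizer_def carrier_Sym)
  interpret F2_omega scale by fact
  interpret GL_supergroup scale G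
  proof
    show bij: "bij g" if "g \<in> G" for g
      using that assms(5) stab by blast
    show "g \<circ> h \<in> G" if "g \<in> G" "h \<in> G" for g h
      using that bij subgroup.m_closed[OF assms(2)] mult_Sym by metis
    show "Hilbert_Choice.inv g \<in> G" if "g \<in> G" for g
      using that bij subgroup.m_inv_closed[OF assms(2)] inv_Sym by metis
    show "g 0 = 0" if "g \<in> G" for g
      using that assms(5) stab by blast
    show "GL scale \<subseteq> G" using assms(4) by blast
  qed
  show "Sym_stab 0 \<subseteq> G"
  proof
    fix \<pi> :: "'v \<Rightarrow> 'v" assume "\<pi> \<in> Sym_stab 0"
    then have \<pi>: "bij \<pi>" "\<pi> 0 = 0" by (auto simp: stab)
    \<comment> \<open>Agreement on every finite set is the density that closedness of
      \<open>G\<close> turns into membership.\<close>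
    have "\<exists>\<sigma>\<in>G. restrict \<sigma> S = restrict \<pi> S" if "finite S" for S
      using ex_G_agreeing[OF _ \<pi> that] assms(4) by (metis psubset_eq restrict_ext)
    then show "\<pi> \<in> G"
      using assms(3) \<pi>(1) by (simp add: closed_in_Sym_def carrier_Sym)
  qed
qed (use assms(5) in blast)

end
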